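(* (i) For all $m\in\mathbb{N}$ and all $x,y,t\in\mathbb{R}$ with $1+p_2(x,y;t)>0$, $$\partial_t^m\frac{1}{\sqrt{1+p_2(x,y;t)}}=m!\,\frac{P_m\left(\dfrac{p_2^{(1)}(x,y;t)}{1+p_2(x,y;t)},\dfrac{1}{2!}\dfrac{p_2^{(2)}(x,y;t)}{1+p_2(x,y;t)}\right)}{\sqrt{1+p_2(x,y;t)}}.$$ (ii) More generally, for all integers $m\ge 2$, $n\ge 1$ and all $x,y,t\in\mathbb{R}$ with $1+p_m(x,y;t)>0$, $$\partial_t^n\frac{1}{\sqrt{1+p_m(x,y;t)}}=n!\,\frac{P_n^{(n,n-1,\dots,1)}\left(\dfrac{1}{1!}\dfrac{p_m^{(1)}(x,y;t)}{1+p_m(x,y;t)},\dots,\dfrac{1}{n!}\dfrac{p_m^{(n)}(x,y;t)}{1+p_m(x,y;t)}\right)}{\sqrt{1+p_m(x,y;t)}}.$$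
   Context: For $m\ge 2$, $p_m(x,y;t)=x\,t+y\,t^m$ and $p_m^{(k)}(x,y;t)=\partial_t^k p_m(x,y;t)$. The two-variable Hermite polynomials are $H_n(x,y)=n!\sum_{r=0}^{\lfloor n/2\rfloor}\frac{x^{n-2r}y^r}{(n-2r)!\,r!}$, and the two-variable Legendre polynomials are $$P_n(x,y)=\frac{1}{n!\,\Gamma(1/2)}\int_0^\infty e^{-s}s^{-1/2}H_n(-sx,-sy)\,ds=\frac{(-1)^n}{\sqrt\pi}\sum_{r=0}^{\lfloor n/2\rfloor}\frac{\Gamma(n-r+\frac12)\,x^{n-2r}(-y)^r}{(n-2r)!\,r!}.$$ The complete $p$-variable Hermite polynomials $H_n^{(p,p-1,\dots,1)}(x_1,\dots,x_p)$ are defined by $\sum_{n\ge0}\frac{t^n}{n!}H_n^{(p,\dots,1)}(x_1,\dots,x_p)=\exp\bigl(\sum_{s=1}^p x_s t^s\bigr)$, and the complete $p$-variable Legendre polynomials by $$P_n^{(p,p-1,\dots,1)}(x_1,\dots,x_p)=\frac{1}{n!\,\Gamma(1/2)}\int_0^\infty e^{-s}s^{-1/2}H_n^{(p,p-1,\dots,1)}(-sx_1,\dots,-sx_p)\,ds.$$ *)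

theory Defs
  imports "HOL-Analysis.Analysis"
begin

definition p_poly :: "nat \<Rightarrow> real \<Rightarrow> real \<Rightarrow> real \<Rightarrow> real" where
  "p_poly m x y t = x * t + y * t ^ m"

definition p_deriv :: "nat \<Rightarrow> nat \<Rightarrow> real \<Rightarrow> real \<Rightarrow> real \<Rightarrow> real" where
  "p_deriv m k x y t = (deriv ^^ k) (\<lambda>u. p_poly m x y u) t"

definition Hermite2 :: "nat \<Rightarrow> real \<Rightarrow> real \<Rightarrow> real" where
  "Hermite2 n x y =
     fact n * (\<Sum>r = 0..n div 2. x ^ (n - 2 * r) * y ^ r / (fact (n - 2 * r) * fact r))"

definition Legendre2 :: "nat \<Rightarrow> real \<Rightarrow> real \<Rightarrow> real" where
  "Legendre2 n x y = 1 / (fact n * Gamma (1/2)) *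
     integral {0..} (\<lambda>s. exp (- s) * s powr (- 1/2) * Hermite2 n (- s * x) (- s * y))"

text \<open>
  The variables \<open>x\<^sub>1, \<dots>, x\<^sub>p\<close> are the values \<open>x 1, \<dots>, x p\<close> of a function on the naturals; its
  other values are never used. The exponential generating function is read as an identity of
  formal power series in \<open>t\<close>, so \<open>H\<^sub>n\<close> is \<open>n!\<close> times the coefficient of \<open>t^n\<close> in the formal series
  \<open>exp (x\<^sub>1 t + \<dots> + x\<^sub>p t^p)\<close>.
\<close>

definition Hermite_complete :: "nat \<Rightarrow> nat \<Rightarrow> (nat \<Rightarrow> real) \<Rightarrow> real" where
  "Hermite_complete p n x =
     fact n * fps_nth (fps_compose (fps_exp 1) (\<Sum>s = 1..p. fps_const (x s) * fps_X ^ s)) n"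

definition Legendre_complete :: "nat \<Rightarrow> nat \<Rightarrow> (nat \<Rightarrow> real) \<Rightarrow> real" where
  "Legendre_complete p n x = 1 / (fact n * Gamma (1/2)) *
     integral {0..} (\<lambda>s. exp (- s) * s powr (- 1/2) * Hermite_complete p n (\<lambda>k. - s * x k))"

end

theory Submission
  imports Defs
begin

text \<open>
  With \<open>f = 1 + p\<close>, the coefficient of \<open>h^n\<close> in \<open>f(t + h) powr (-1/2)\<close> is
  \<open>f(t) powr (-1/2)\<close> times that of \<open>(1 + A) powr (-1/2)\<close>, where \<open>A\<close> is the series of the
  \<open>p\<^sup>(\<^sup>k\<^sup>)(t) / (k! f(t)) h^k\<close>, \<open>k \<ge> 1\<close>. Convergence plays no role: the formal coefficients of the
  composition satisfy the recursion of the iterated derivatives (Faa di Bruno's formula). On the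
  other side, integrating \<open>exp (- s) s powr (-1/2) exp (- s A)\<close> termwise turns the exponential series
  into the binomial series with exponent \<open>-1/2\<close>.
\<close>

unbundle no vec_syntax
unbundle fps_syntax

section \<open>Coefficientwise differentiation of formal power series that depend on a
  parameter\<close>

lemma fps_mult_coeff_derivative:
  fixes F G :: "real \<Rightarrow> real fps"
  assumes "\<And>n. ((\<lambda>t. F t $ n) has_real_derivative F' $ n) (at t)"
    and "\<And>n. ((\<lambda>t. G t $ n) has_real_derivative G' $ n) (at t)"
  shows "((\<lambda>t. (F t * G t) $ n) has_real_derivative (F' * G t + F t * G') $ n) (at t)"
  unfolding fps_mult_nth fps_add_nth sum.distrib[symmetric]
  by (rule DERIV_sum) (auto intro!: derivative_eq_intros assms)

lemma fps_power_coeff_derivative: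
  fixes F :: "real \<Rightarrow> real fps"
  assumes "\<And>n. ((\<lambda>t. F t $ n) has_real_derivative F' $ n) (at t)"
  shows "((\<lambda>t. (F t ^ i) $ n) has_real_derivative (of_nat i * F t ^ (i - 1) * F') $ n) (at t)"
proof (induction i arbitrary: n)
  case 0
  then show ?case by simp
next
  case (Suc i)
  have "F' * F t ^ i + F t * (of_nat i * F t ^ (i - 1) * F') = of_nat (Suc i) * F t ^ i * F'"
    by (cases i) (simp_all add: algebra_simps)
  then show ?case
    using fps_mult_coeff_derivative[OF assms Suc.IH, of n] by simp
qed

text \<open>Each coefficient of a composition is a finite sum of terms
  \<open>F t $ i * (G t ^ i) $ n\<close>, so it can be differentiated term by term. The work lies in
  recognising the result as the chain rule.\<close>

lemma fps_compose_coeff_derivative: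
  fixes F G :: "real \<Rightarrow> real fps"
  assumes F: "\<And>n. ((\<lambda>t. F t $ n) has_real_derivative F' $ n) (at t)"
    and G: "\<And>n. ((\<lambda>t. G t $ n) has_real_derivative G' $ n) (at t)"
    and G0: "G t $ 0 = 0" and G'0: "G' $ 0 = 0"
  shows "((\<lambda>t. (F t oo G t) $ n) has_real_derivative
           ((F' oo G t) + (fps_deriv (F t) oo G t) * G') $ n) (at t)"
proof -
  let ?H = "fps_deriv (F t)"
  have of_nat_mult_nth: "(of_nat i * E) $ n = of_nat i * E $ n" for i and E :: "real fps"
    by (simp add: fps_of_nat[symmetric])
  \<comment> \<open>The formal product involves \<open>G t ^ i\<close> for i \<le> n, the termwise
    derivative only \<open>G t ^ (i - 1)\<close>. The surplus top term vanishes: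
    \<open>G t ^ n\<close> has no coefficient below n, and \<open>G'\<close> has no constant
    term.\<close>
  have last: "(G t ^ n * G') $ n = 0"
  proof -
    have zero: "(G t ^ n) $ l * G' $ (n - l) = 0" if "l \<le> n" for l
      using that startsby_zero_power_prefix[OF G0, of n] G'0 by (cases "l = n") auto
    show ?thesis
      unfolding fps_mult_nth by (rule sum.neutral) (use zero in auto)
  qed
  have "((?H oo G t) * G') $ n = (\<Sum>l=0..n. (\<Sum>i=0..l. ?H $ i * (G t ^ i) $ l) * G' $ (n - l))"
    by (simp add: fps_mult_nth fps_compose_nth)
  \<comment> \<open>The coefficients added here are 0, since \<open>(G t ^ i) $ l = 0\<close> for i
    > l; with ranges independent of each other the sums can be swapped.\<close>
  also have "\<dots> = (\<Sum>l=0..n. (\<Sum>i=0..n. ?H $ i * (G t ^ i) $ l) * G' $ (n - l))"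
    by (intro sum.cong refl arg_cong2[of _ _ _ _ "(*)"] sum.mono_neutral_left)
       (auto simp: startsby_zero_power_prefix[OF G0])
  also have "\<dots> = (\<Sum>i=0..n. ?H $ i * (G t ^ i * G') $ n)"
    by (subst sum_distrib_right, subst sum.swap)
       (simp add: fps_mult_nth sum_distrib_left mult.assoc)
  also have "\<dots> = (\<Sum>i<n. ?H $ i * (G t ^ i * G') $ n)"
    using last by (simp add: atLeast0AtMost lessThan_Suc_atMost[symmetric])
  \<comment> \<open>Index shift using \<open>?H $ i = (i + 1) * F t $ (i + 1)\<close>; the new term
    i = 0 is killed by its factor i.\<close>
  also have "\<dots> = (\<Sum>i<Suc n. F t $ i * (of_nat i * G t ^ (i - 1) * G') $ n)"
    by (subst sum.lessThan_Suc_shift)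
       (simp add: of_nat_mult_nth mult.assoc mult.left_commute[where a = "F t $ i" for i] del: of_nat_Suc)
  also have "\<dots> = (\<Sum>i=0..n. F t $ i * (of_nat i * G t ^ (i - 1) * G') $ n)"
    by (simp only: lessThan_Suc_atMost atLeast0AtMost)
  finally have eq: "((F' oo G t) + (?H oo G t) * G') $ n =
      (\<Sum>i=0..n. F' $ i * (G t ^ i) $ n + F t $ i * (of_nat i * G t ^ (i - 1) * G') $ n)"
    by (simp add: fps_compose_nth sum.distrib)
  show ?thesis
    unfolding eq unfolding fps_compose_nth
    by (rule DERIV_sum) (auto intro!: derivative_eq_intros F fps_power_coeff_derivative[OF G])
qed

text \<open>
  Faa di Bruno's formula. Think of \<open>r j = \<phi>\<^sup>(\<^sup>j\<^sup>) \<circ> p\<close> and \<open>q k = p\<^sup>(\<^sup>k\<^sup>)\<close>. Writing \<open>R\<close> and \<open>D\<close> for the two series,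
  \<open>dR/dt = p' R'\<close> and \<open>dD/dt = D' - p'\<close> coefficientwise, so the terms with \<open>p'\<close> cancel in the chain rule
  and \<open>d/dt (R oo D)\<close> is the formal derivative of \<open>R oo D\<close>.
\<close>

lemma higher_deriv_eq_compose_coeff:
  fixes r q :: "nat \<Rightarrow> real \<Rightarrow> real"
  assumes "open S" "t \<in> S"
    and r: "\<And>j t. t \<in> S \<Longrightarrow> (r j has_real_derivative r (Suc j) t * q 1 t) (at t)"
    and q: "\<And>k t. t \<in> S \<Longrightarrow> k \<ge> 1 \<Longrightarrow> (q k has_real_derivative q (Suc k) t) (at t)"
  shows "(deriv ^^ n) (r 0) t =
    fact n * (Abs_fps (\<lambda>j. r j t / fact j) oo Abs_fps (\<lambda>k. if k = 0 then 0 else q k t / fact k)) $ n"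
  using \<open>t \<in> S\<close>
proof (induction n arbitrary: t)
  case 0
  then show ?case by simp
next
  case (Suc n)
  define R where "R = (\<lambda>t. Abs_fps (\<lambda>j. r j t / fact j))"
  define D where "D = (\<lambda>t. Abs_fps (\<lambda>k. if k = 0 then 0 else q k t / fact k))"
  have R': "((\<lambda>t. R t $ j) has_real_derivative (fps_const (q 1 t) * fps_deriv (R t)) $ j) (at t)" for j
    by (auto simp: R_def field_simps simp del: of_nat_Suc intro!: derivative_eq_intros r Suc.prems)
  have D': "((\<lambda>t. D t $ k) has_real_derivative (fps_deriv (D t) - fps_const (q 1 t)) $ k) (at t)" for k
    by (cases "k = 0")
       (auto simp: D_def field_simps simp del: of_nat_Suc intro!: derivative_eq_intros q Suc.prems)
  have D0: "D t $ 0 = 0" and D'0: "(fps_deriv (D t) - fps_const (q 1 t)) $ 0 = 0"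
    by (simp_all add: D_def)
  have "(fps_const (q 1 t) * fps_deriv (R t) oo D t) +
          (fps_deriv (R t) oo D t) * (fps_deriv (D t) - fps_const (q 1 t)) = fps_deriv (R t oo D t)"
    using D0 by (simp add: fps_compose_deriv fps_compose_mult_distrib algebra_simps)
  with fps_compose_coeff_derivative[OF R' D' D0 D'0, of n]
  have "((\<lambda>t. (R t oo D t) $ n) has_real_derivative fps_deriv (R t oo D t) $ n) (at t)"
    by (simp only:)
  then have "((\<lambda>t. fact n * (R t oo D t) $ n) has_real_derivative
      fact n * fps_deriv (R t oo D t) $ n) (at t)"
    by (rule DERIV_cmult)
  \<comment> \<open>Differentiating once more needs the formula in a neighbourhood of
    \<open>t\<close>, which openness of \<open>S\<close> provides.\<close>
  moreover have "\<forall>\<^sub>F u in nhds t. (deriv ^^ n) (r 0) u = fact n * (R u oo D u) $ n"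
    using eventually_nhds_in_open[OF \<open>open S\<close> Suc.prems]
    by eventually_elim (simp add: Suc.IH R_def D_def)
  ultimately have "deriv ((deriv ^^ n) (r 0)) t = fact n * fps_deriv (R t oo D t) $ n"
    by (subst deriv_cong_ev) (auto intro: DERIV_imp_deriv)
  then show ?case
    by (simp add: R_def D_def mult_ac)
qed

lemma fps_power_nth_cong:
  assumes "\<And>k. k \<le> n \<Longrightarrow> F $ k = G $ k"
  shows "(F ^ i) $ n = (G ^ i) $ n"
  using assms
proof (induction i arbitrary: n)
  case (Suc i)
  then show ?case by (auto simp: fps_mult_nth intro!: sum.cong)
qed simp

lemma fps_compose_nth_cong:
  assumes "\<And>k. k \<le> n \<Longrightarrow> F $ k = G $ k"
  shows "(E oo F) $ n = (E oo G) $ n"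
  using fps_power_nth_cong[OF assms] by (simp add: fps_compose_nth)

section \<open>Derivatives of the inverse square root as coefficients of a binomial series\<close>

lemma p_deriv_eq_poly:
  "p_deriv m k x y = poly ((pderiv ^^ k) ([:0, x:] + monom y m))"
proof (induction k)
  case 0
  then show ?case by (auto simp: p_deriv_def p_poly_def poly_monom)
next
  case (Suc k)
  have *: "p_deriv m k x y = (deriv ^^ k) (p_poly m x y)" for k
    by (auto simp: p_deriv_def)
  have "p_deriv m (Suc k) x y = deriv (p_deriv m k x y)"
    unfolding * by simp
  then show ?case
    unfolding Suc by (auto intro!: DERIV_imp_deriv poly_DERIV)
qed

lemma p_deriv_has_derivative:
  "(p_deriv m k x y has_real_derivative p_deriv m (Suc k) x y t) (at t)"
  unfolding p_deriv_eq_poly by (simp add: poly_DERIV)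

lemma higher_deriv_inverse_sqrt_p_poly:
  assumes pos: "1 + p_poly m x y t > 0"
  shows "(deriv ^^ n) (\<lambda>u. 1 / sqrt (1 + p_poly m x y u)) t = fact n *
    ((fps_binomial (-1/2) oo
      Abs_fps (\<lambda>k. if k = 0 then 0 else 1 / fact k * (p_deriv m k x y t / (1 + p_poly m x y t)))) $ n
     / sqrt (1 + p_poly m x y t))"
proof -
  define f where "f = (\<lambda>u. 1 + p_poly m x y u)"
  define S where "S = {u. f u > 0}"
  \<comment> \<open>This is the j-th derivative of z powr (-1/2), evaluated at
    \<open>f u\<close>.\<close>
  define r where "r = (\<lambda>j u. fact j * ((-1/2) gchoose j) * f u powr (-1/2 - real j))"
  have f': "(f has_real_derivative p_deriv m 1 x y u) (at u)" for u
  proof -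
    have "p_poly m x y = p_deriv m 0 x y" by (auto simp: p_deriv_def)
    then show ?thesis
      using p_deriv_has_derivative[of m 0 x y u] by (auto simp: f_def intro!: derivative_eq_intros)
  qed
  have "continuous_on UNIV f"
    using f' by (meson DERIV_continuous continuous_at_imp_continuous_on)
  then have "open S"
    unfolding S_def by (intro open_Collect_less) auto
  have "t \<in> S" using pos by (simp add: S_def f_def)
  have r': "(r j has_real_derivative r (Suc j) u * p_deriv m 1 x y u) (at u)" if "u \<in> S" for j u
  proof -
    have "real (Suc j) * ((-1/2) gchoose Suc j) = (-1/2 - real j) * ((-1/2) gchoose j)"
      by (simp only: gbinomial_absorb_comp gbinomial_absorption)
    then have "fact (Suc j) * ((-1/2) gchoose Suc j) = fact j * ((-1/2 - real j) * ((-1/2) gchoose j))"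
      by (simp add: mult_ac del: of_nat_Suc)
    then have coeff: "fact (Suc j) * ((-1/2) gchoose Suc j) * f u powr (-1/2 - real (Suc j)) * p_deriv m 1 x y u =
        fact j * ((-1/2) gchoose j) * ((-1/2 - real j) * f u powr (-1/2 - real j - of_nat 1) * p_deriv m 1 x y u)"
      by (simp add: mult_ac diff_diff_eq2 add.commute del: fact_Suc)
    have "f u > 0" using that by (simp add: S_def)
    show ?thesis
      unfolding r_def coeff by (intro DERIV_cmult DERIV_fun_powr f' \<open>f u > 0\<close>)
  qed
  have powr_neg_half: "z powr (- (1/2)) = 1 / sqrt z" if "z > 0" for z :: real
    using that by (simp add: powr_minus_divide powr_half_sqrt)
  define D where "D = Abs_fps (\<lambda>k. if k = 0 then 0 else p_deriv m k x y t / fact k)"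
  define A where "A = Abs_fps (\<lambda>k. if k = 0 then 0 else 1 / fact k * (p_deriv m k x y t / f t))"
  \<comment> \<open>In the j-th term of the composition, the factor \<open>f t ^ j\<close> pulled
    out here cancels the j in the exponent -1/2 - j, leaving the common factor
    \<open>1 / sqrt (f t)\<close>.\<close>
  have DA: "D = fps_const (f t) * A"
    using \<open>t \<in> S\<close> by (auto simp: D_def A_def S_def fps_eq_iff)
  have "(deriv ^^ n) (\<lambda>u. 1 / sqrt (f u)) t = (deriv ^^ n) (r 0) t"
  proof (rule higher_deriv_cong_ev)
    show "\<forall>\<^sub>F u in nhds t. 1 / sqrt (f u) = r 0 u"
      using eventually_nhds_in_open[OF \<open>open S\<close> \<open>t \<in> S\<close>]
      by eventually_elim (simp add: r_def S_def powr_neg_half)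
  qed simp
  also have "\<dots> = fact n * (Abs_fps (\<lambda>j. r j t / fact j) oo D) $ n"
    unfolding D_def
    by (rule higher_deriv_eq_compose_coeff[where r = r and q = "\<lambda>k. p_deriv m k x y", OF \<open>open S\<close> \<open>t \<in> S\<close>])
       (auto simp del: One_nat_def intro: r' p_deriv_has_derivative)
  also have "(Abs_fps (\<lambda>j. r j t / fact j) oo D) $ n = (fps_binomial (-1/2) oo A) $ n / sqrt (f t)"
    unfolding fps_compose_nth sum_divide_distrib
  proof (intro sum.cong refl)
    fix j
    have "f t > 0" using \<open>t \<in> S\<close> by (simp add: S_def)
    have "f t powr (-1/2 - real j) * f t ^ j = f t powr (-1/2)"
      using \<open>f t > 0\<close> by (simp add: powr_realpow[symmetric] powr_add[symmetric])
    also have "\<dots> = 1 / sqrt (f t)"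
      using \<open>f t > 0\<close> by (simp add: powr_neg_half)
    finally have "f t powr (-1/2 - real j) * (f t ^ j * z) = z / sqrt (f t)" for z
      by (simp add: mult.assoc[symmetric])
    then show "Abs_fps (\<lambda>j. r j t / fact j) $ j * D ^ j $ n = fps_binomial (-1/2) $ j * A ^ j $ n / sqrt (f t)"
      by (simp add: r_def DA power_mult_distrib fps_const_power mult.assoc)
  qed
  finally show ?thesis
    unfolding f_def A_def by (simp only: times_divide_eq_right)
qed

section \<open>Legendre polynomials as coefficients of binomial series\<close>

text \<open>Only the powers \<open>A ^ j\<close> with j \<le> n enter, so just finitely many
  integrals are summed. The j-th one is Gamma(j + 1/2) = Gamma(1/2) *
  \<open>pochhammer (1/2) j\<close>, and the factor (-1)^j / j! turns the Pochhammer symbol into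
  \<open>(-1/2) gchoose j\<close>.\<close>

lemma Legendre_integral_fps_exp_compose:
  fixes A :: "real fps"
  shows "1 / Gamma (1/2) * integral {0..} (\<lambda>s. exp (- s) * s powr (- 1/2) *
           (fps_exp 1 oo fps_const (- s) * A) $ n) = (fps_binomial (-1/2) oo A) $ n"
proof -
  have termwise: "((\<lambda>s. exp (- s) * s powr (- 1/2) * ((- s) ^ j / fact j * (A ^ j) $ n))
      has_integral (Gamma (1/2) * ((-1/2) gchoose j) * (A ^ j) $ n)) {0..}" for j
  proof -
    have "((\<lambda>s. s powr (real j + 1/2 - 1) / exp s) has_integral Gamma (real j + 1/2)) {0..}"
      by (rule Gamma_integral_real) simp
    then have "((\<lambda>s. (-1) ^ j / fact j * (A ^ j) $ n * (s powr (real j + 1/2 - 1) / exp s))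
        has_integral ((-1) ^ j / fact j * (A ^ j) $ n * Gamma (real j + 1/2))) {0..}"
      by (rule has_integral_mult_right)
    moreover have "(-1) ^ j / fact j * (A ^ j) $ n * Gamma (real j + 1/2) =
        Gamma (1/2) * ((-1/2) gchoose j) * (A ^ j) $ n"
    proof -
      have half: "(1/2 :: real) \<notin> \<int>\<^sub>\<le>\<^sub>0"
        by (auto elim!: nonpos_Ints_cases)
      have "Gamma (real j + 1/2) = Gamma (1/2) * pochhammer (1/2) j"
        using pochhammer_Gamma[of "1/2 :: real" j] half
        by (simp add: add.commute field_simps Gamma_one_half_real)
      then show ?thesis
        by (simp add: gbinomial_pochhammer)
    qed
    moreover have "(-1) ^ j / fact j * (A ^ j) $ n * (s powr (real j + 1/2 - 1) / exp s) =
        exp (- s) * s powr (- 1/2) * ((- s) ^ j / fact j * (A ^ j) $ n)" if "s \<in> {0..}" for s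
    \<comment> \<open>At the endpoint both sides are 0, because \<open>0 powr a = 0\<close> for
      every exponent.\<close>
    proof (cases "s = 0")
      case False
      with that have "s powr (real j + 1/2 - 1) = s powr (- 1/2) * s ^ j"
        by (simp add: powr_realpow[symmetric] powr_add[symmetric])
      moreover have "exp (- s) = 1 / exp s"
        by (simp add: exp_minus divide_inverse)
      moreover have "(- s) ^ j = (-1) ^ j * s ^ j"
        by (rule power_minus)
      ultimately show ?thesis
        by (simp add: mult_ac)
    qed simp
    ultimately show ?thesis
      by (metis (no_types, lifting) has_integral_cong)
  qed
  have "((\<lambda>s. \<Sum>j=0..n. exp (- s) * s powr (- 1/2) * ((- s) ^ j / fact j * (A ^ j) $ n))
      has_integral (\<Sum>j=0..n. Gamma (1/2) * ((-1/2) gchoose j) * (A ^ j) $ n)) {0..}"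
    by (rule has_integral_sum[OF _ termwise]) simp
  moreover have "exp (- s) * s powr (- 1/2) * (fps_exp 1 oo fps_const (- s) * A) $ n =
      (\<Sum>j=0..n. exp (- s) * s powr (- 1/2) * ((- s) ^ j / fact j * (A ^ j) $ n))" for s
    unfolding fps_compose_nth sum_distrib_left power_mult_distrib fps_const_power by simp
  ultimately have "integral {0..} (\<lambda>s. exp (- s) * s powr (- 1/2) *
      (fps_exp 1 oo fps_const (- s) * A) $ n) = Gamma (1/2) * (fps_binomial (-1/2) oo A) $ n"
    by (simp add: integral_unique fps_compose_nth sum_distrib_left mult.assoc)
  then show ?thesis
    by (simp add: Gamma_one_half_real)
qed

lemma Legendre_complete_eq:
  "Legendre_complete n n c =
     (fps_binomial (-1/2) oo Abs_fps (\<lambda>k. if k = 0 then 0 else c k)) $ n"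
proof -
  let ?A = "Abs_fps (\<lambda>k. if k = 0 then 0 else c k)"
  \<comment> \<open>The defining sum stops at degree n, but the n-th coefficient of the composition
    sees nothing beyond that degree.\<close>
  have "Hermite_complete n n (\<lambda>k. - s * c k) = fact n * (fps_exp 1 oo fps_const (- s) * ?A) $ n" for s
    unfolding Hermite_complete_def
    by (intro arg_cong2[of _ _ _ _ "(*)"] refl fps_compose_nth_cong)
       (simp add: fps_sum_nth fps_X_power_nth if_distrib sum.delta cong: if_cong)
  then show ?thesis
    unfolding Legendre_complete_def Legendre_integral_fps_exp_compose[symmetric]
    by (simp add: mult.left_commute[of _ "fact n"] integral_mult_right)
qed

text \<open>Factoring X^(n - r) out of the power leaves the coefficient of X^r in (x + y X)^(n - r).
  If 2 r > n the binomial coefficient is 0, so the truncated exponent \<open>n - 2 * r\<close> does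
  no harm.\<close>

lemma linear_plus_quadratic_power_nth:
  fixes x y :: real
  assumes "r \<le> n"
  shows "((fps_const x * fps_X + fps_const y * fps_X ^ 2) ^ (n - r)) $ n =
    of_nat ((n - r) choose r) * x ^ (n - 2 * r) * y ^ r"
proof -
  have "(fps_const x * fps_X + fps_const y * fps_X ^ 2) ^ (n - r) =
      fps_X ^ (n - r) * (fps_const y * fps_X + fps_const x) ^ (n - r)"
    by (simp add: power_mult_distrib[symmetric] algebra_simps power2_eq_square)
  also have "\<dots> $ n = ((fps_const y * fps_X + fps_const x) ^ (n - r)) $ r"
    using assms by (simp add: fps_X_power_mult_nth)
  also have "\<dots> = (\<Sum>k\<le>n - r. if k = r then of_nat ((n - r) choose k) * x ^ (n - r - k) * y ^ k else 0)"
    unfolding binomial_ring fps_sum_nth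
    by (intro sum.cong refl)
       (simp add: power_mult_distrib fps_const_power fps_of_nat[symmetric] fps_X_power_nth mult_ac
          del: fps_of_nat)
  also have "\<dots> = of_nat ((n - r) choose r) * x ^ (n - 2 * r) * y ^ r"
    by (simp add: sum.delta binomial_eq_0 mult_2)
  finally show ?thesis .
qed

lemma Hermite2_eq:
  "Hermite2 n x y = fact n * (fps_exp 1 oo (fps_const x * fps_X + fps_const y * fps_X ^ 2)) $ n"
proof -
  have "(fps_exp 1 oo (fps_const x * fps_X + fps_const y * fps_X ^ 2)) $ n =
      (\<Sum>j=0..n. 1 / fact j * ((fps_const x * fps_X + fps_const y * fps_X ^ 2) ^ j) $ n)"
    by (simp add: fps_compose_nth)
  \<comment> \<open>Substituting j = n - r makes r the exponent of y, as in
    \<open>Hermite2\<close>.\<close>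
  also have "\<dots> = (\<Sum>r=0..n. 1 / fact (n - r) * ((fps_const x * fps_X + fps_const y * fps_X ^ 2) ^ (n - r)) $ n)"
    by (rule sum.reindex_bij_witness[of _ "\<lambda>r. n - r" "\<lambda>r. n - r"]) auto
  also have "\<dots> = (\<Sum>r=0..n. 1 / fact (n - r) * (of_nat ((n - r) choose r) * x ^ (n - 2 * r) * y ^ r))"
    by (intro sum.cong refl) (simp add: linear_plus_quadratic_power_nth)
  also have "\<dots> = (\<Sum>r=0..n div 2. 1 / fact (n - r) * (of_nat ((n - r) choose r) * x ^ (n - 2 * r) * y ^ r))"
    by (rule sum.mono_neutral_right) (auto intro!: binomial_eq_0)
  also have "\<dots> = (\<Sum>r = 0..n div 2. x ^ (n - 2 * r) * y ^ r / (fact (n - 2 * r) * fact r))"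
  proof (intro sum.cong refl)
    fix r assume "r \<in> {0..n div 2}"
    then have "r \<le> n - r" "n - r - r = n - 2 * r" by auto
    then show "1 / fact (n - r) * (of_nat ((n - r) choose r) * x ^ (n - 2 * r) * y ^ r) =
        x ^ (n - 2 * r) * y ^ r / (fact (n - 2 * r) * fact r)"
      by (simp add: binomial_fact field_simps)
  qed
  finally show ?thesis by (simp add: Hermite2_def)
qed

lemma Legendre2_eq:
  "Legendre2 n x y = (fps_binomial (-1/2) oo (fps_const x * fps_X + fps_const y * fps_X ^ 2)) $ n"
proof -
  let ?A = "fps_const x * fps_X + fps_const y * fps_X ^ 2"
  have "fps_const (- s * x) * fps_X + fps_const (- s * y) * fps_X ^ 2 = fps_const (- s) * ?A" for s
    by (simp only: fps_const_mult[symmetric] distrib_left mult.assoc)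
  then have "Hermite2 n (- s * x) (- s * y) = fact n * (fps_exp 1 oo fps_const (- s) * ?A) $ n" for s
    by (simp only: Hermite2_eq)
  then show ?thesis
    unfolding Legendre2_def Legendre_integral_fps_exp_compose[symmetric]
    by (simp add: mult.left_commute[of _ "fact n"] integral_mult_right)
qed

text \<open>This cuts the series of scaled derivatives down to its linear and quadratic terms, so
  that two variables suffice when the exponent is 2.\<close>

lemma p_deriv_quadratic_eq_0:
  assumes "k > 2"
  shows "p_deriv 2 k x y t = 0"
proof -
  have "(pderiv ^^ k) p = 0" if "degree p < k" for p :: "real poly"
    using that
  proof (induction k arbitrary: p)
    case (Suc k)
    show ?case
    proof (cases k)
      case 0
      then show ?thesis using Suc.prems by (simp add: pderiv_eq_0_iff)
    next
      case (Suc k')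
      then show ?thesis using Suc.prems Suc.IH[of "pderiv p"]
        by (simp add: funpow_swap1 degree_pderiv)
    qed
  qed simp
  moreover have "degree ([:0, x:] + monom y 2) \<le> 2"
    by (intro degree_add_le) (auto simp: degree_monom_le)
  ultimately show ?thesis
    using assms by (simp add: p_deriv_eq_poly)
qed

theorem mainTheorem2:
  shows "(\<forall>(m::nat) (x::real) (y::real) (t::real). 1 + p_poly 2 x y t > 0 \<longrightarrow>
            (deriv ^^ m) (\<lambda>u. 1 / sqrt (1 + p_poly 2 x y u)) t =
              fact m *
              (Legendre2 m (p_deriv 2 1 x y t / (1 + p_poly 2 x y t))
                           (1 / fact 2 * (p_deriv 2 2 x y t / (1 + p_poly 2 x y t)))
               / sqrt (1 + p_poly 2 x y t)))
       \<and> (\<forall>(m::nat) (n::nat) (x::real) (y::real) (t::real).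
            m \<ge> 2 \<longrightarrow> n \<ge> 1 \<longrightarrow> 1 + p_poly m x y t > 0 \<longrightarrow>
            (deriv ^^ n) (\<lambda>u. 1 / sqrt (1 + p_poly m x y u)) t =
              fact n *
              (Legendre_complete n n
                 (\<lambda>k. 1 / fact k * (p_deriv m k x y t / (1 + p_poly m x y t)))
               / sqrt (1 + p_poly m x y t)))"
proof (intro conjI allI impI)
  fix m :: nat and x y t :: real
  assume pos: "1 + p_poly 2 x y t > 0"
  let ?c = "\<lambda>k. 1 / fact k * (p_deriv 2 k x y t / (1 + p_poly 2 x y t))"
  have "Abs_fps (\<lambda>k. if k = 0 then 0 else ?c k) =
      fps_const (p_deriv 2 1 x y t / (1 + p_poly 2 x y t)) * fps_X + fps_const (?c 2) * fps_X ^ 2"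
  proof (rule fps_ext)
    fix k :: nat
    consider "k = 0" | "k = 1" | "k = 2" | "k > 2" by linarith
    then show "Abs_fps (\<lambda>k. if k = 0 then 0 else ?c k) $ k =
        (fps_const (p_deriv 2 1 x y t / (1 + p_poly 2 x y t)) * fps_X + fps_const (?c 2) * fps_X ^ 2) $ k"
      by cases (simp_all add: fps_X_power_nth p_deriv_quadratic_eq_0)
  qed
  then show "(deriv ^^ m) (\<lambda>u. 1 / sqrt (1 + p_poly 2 x y u)) t =
      fact m * (Legendre2 m (p_deriv 2 1 x y t / (1 + p_poly 2 x y t)) (?c 2) / sqrt (1 + p_poly 2 x y t))"
    using higher_deriv_inverse_sqrt_p_poly[OF pos, of m] by (simp only: Legendre2_eq)
next
  fix m n :: nat and x y t :: real
  assume pos: "1 + p_poly m x y t > 0"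
  then show "(deriv ^^ n) (\<lambda>u. 1 / sqrt (1 + p_poly m x y u)) t =
      fact n * (Legendre_complete n n
        (\<lambda>k. 1 / fact k * (p_deriv m k x y t / (1 + p_poly m x y t))) / sqrt (1 + p_poly m x y t))"
    by (simp only: Legendre_complete_eq higher_deriv_inverse_sqrt_p_poly)
qed

end
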